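(* Let $t,r\ge 0$ be real numbers with $t^2+r^2=1$, let $\sigma\in[0,\pi]$, and set $c=t^4+r^4-2r^2t^2\cos\sigma$. Let $\mathbb{P}(1)$ be the outcome probability of the non-ideal photonic swap test circuit, as a function of the input amplitudes $(\alpha,\beta,\gamma,\delta)\in\mathbb{C}^4$ and of the phase errors $\epsilon_1,\dots,\epsilon_8\in\mathbb{R}$. Then the maximum of $\mathbb{P}(1)$ over all pure separable input states, i.e. over $$A=\{(\alpha,\beta,\gamma,\delta)\in\mathbb{C}^4:\ |\alpha\beta-\gamma\delta|^2=0,\ |\alpha|^2+|\beta|^2+|\gamma|^2+|\delta|^2=1\},$$ and over all phase errors whose relative values $\epsilon_2-\epsilon_1,\ \epsilon_4-\epsilon_3,\ \epsilon_6-\epsilon_5,\ \epsilon_8-\epsilon_7$ lie in $[-\sigma,\sigma]$, is equal to $$\frac12+\frac c2 .$$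
   Context: The input is the pure two-qubit state $\alpha|00\rangle+\gamma|10\rangle+\delta|01\rangle+\beta|11\rangle$. It is a product (separable) state exactly when $\alpha\beta=\gamma\delta$. In the photonic circuit the Hadamard gates on the ancilla are replaced by non-ideal beam splitters $\begin{pmatrix}t&\mathrm{i}r\\ \mathrm{i}r&t\end{pmatrix}$, with transmission coefficient $t$ and reflection coefficient $r$. A layer of phase shifters, placed after the controlled-SWAP gate, multiplies the eight path modes by phases $e^{\mathrm{i}\epsilon_1},\dots,e^{\mathrm{i}\epsilon_8}$, where the $\epsilon_k$ are phase errors and the nominal phases are zero. The outcome probability, in the labelling convention where it plays the role of the standard swap test probability of finding the ancilla in $|1\rangle$, is $$\mathbb{P}(1)=|\alpha|^2\,|t^2e^{\mathrm{i}\epsilon_1}-r^2e^{\mathrm{i}\epsilon_2}|^2+|\beta|^2\,|t^2e^{\mathrm{i}\epsilon_7}-r^2e^{\mathrm{i}\epsilon_8}|^2+|\delta t^2e^{\mathrm{i}\epsilon_3}-\gamma r^2e^{\mathrm{i}\epsilon_4}|^2+|\gamma t^2e^{\mathrm{i}\epsilon_5}-\delta r^2e^{\mathrm{i}\epsilon_6}|^2 .$$ *)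

theory Defs
  imports "HOL-Analysis.Analysis"
begin

text \<open>
  A quadruple \<open>(\<alpha>, \<beta>, \<gamma>, \<delta>)\<close> stands for the two-qubit vector
  \<open>\<alpha>|00> + \<gamma>|10> + \<delta>|01> + \<beta>|11>\<close>; note the order of the amplitudes.
\<close>

type_synonym amplitudes = "complex \<times> complex \<times> complex \<times> complex"

definition separable_states :: "amplitudes set" where
  "separable_states = {(\<alpha>, \<beta>, \<gamma>, \<delta>).
     (cmod (\<alpha> * \<beta> - \<gamma> * \<delta>))\<^sup>2 = 0 \<and>
     (cmod \<alpha>)\<^sup>2 + (cmod \<beta>)\<^sup>2 + (cmod \<gamma>)\<^sup>2 + (cmod \<delta>)\<^sup>2 = 1}"

text \<open>
  The eight phase errors form a vector \<open>\<epsilon>\<close> indexed by the numeral type \<open>8\<close>, in which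
  \<open>1, ..., 8\<close> are the eight distinct indices (with \<open>8 = 0\<close>).
\<close>

definition admissible_phases :: "real \<Rightarrow> (real ^ 8) set" where
  "admissible_phases \<sigma> = {\<epsilon>.
     \<epsilon> $ 2 - \<epsilon> $ 1 \<in> {-\<sigma>..\<sigma>} \<and> \<epsilon> $ 4 - \<epsilon> $ 3 \<in> {-\<sigma>..\<sigma>} \<and>
     \<epsilon> $ 6 - \<epsilon> $ 5 \<in> {-\<sigma>..\<sigma>} \<and> \<epsilon> $ 8 - \<epsilon> $ 7 \<in> {-\<sigma>..\<sigma>}}"

text \<open>
  The probability of the outcome labelled \<open>1\<close> of the photonic swap test whose ancilla beam
  splitters have transmission coefficient \<open>t\<close> and reflection coefficient \<open>r\<close>. Each squared
  modulus belongs to one output mode; \<open>t\<^sup>2\<close> and \<open>-r\<^sup>2 = (\<i> r)\<^sup>2\<close> are the weights of the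
  two paths that interfere in it, transmitted or reflected at both beam splitters.
\<close>

definition prob1 :: "real \<Rightarrow> real \<Rightarrow> amplitudes \<Rightarrow> real ^ 8 \<Rightarrow> real" where
  "prob1 t r = (\<lambda>(\<alpha>, \<beta>, \<gamma>, \<delta>) \<epsilon>.
     (cmod \<alpha>)\<^sup>2 * (cmod (t\<^sup>2 * cis (\<epsilon> $ 1) - r\<^sup>2 * cis (\<epsilon> $ 2)))\<^sup>2 +
     (cmod \<beta>)\<^sup>2 * (cmod (t\<^sup>2 * cis (\<epsilon> $ 7) - r\<^sup>2 * cis (\<epsilon> $ 8)))\<^sup>2 +
     (cmod (\<delta> * t\<^sup>2 * cis (\<epsilon> $ 3) - \<gamma> * r\<^sup>2 * cis (\<epsilon> $ 4)))\<^sup>2 +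
     (cmod (\<gamma> * t\<^sup>2 * cis (\<epsilon> $ 5) - \<delta> * r\<^sup>2 * cis (\<epsilon> $ 6)))\<^sup>2)"

end

theory Submission
  imports Defs
begin

text \<open>
  Write \<open>T = t\<^sup>2\<close> and \<open>R = r\<^sup>2\<close>. The phases enter the first two terms only through \<open>cos\<close> of the
  relative errors, so these terms are at most \<open>c\<close> times \<open>p = |\<alpha>|\<^sup>2 + |\<beta>|\<^sup>2\<close>; by the triangle
  inequality the last two are at most \<open>(T\<^sup>2 + R\<^sup>2) q + 4 T R |\<gamma>\<delta>|\<close> with \<open>q = |\<gamma>|\<^sup>2 + |\<delta>|\<^sup>2\<close>.
  Separability makes \<open>2|\<gamma>\<delta>| = 2|\<alpha>\<beta>|\<close> at most both \<open>p\<close> and \<open>q\<close>, and the convex combination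
  of these two bounds with weights \<open>(1 + cos \<sigma>)/2\<close> and \<open>(1 - cos \<sigma>)/2\<close> gives both \<open>p\<close> and
  \<open>q\<close> the same coefficient \<open>(1 + c)/2\<close>.
\<close>

lemma cmod_diff_scaled_cis_squared:
  "(cmod (of_real A * cis a - of_real B * cis b))\<^sup>2 = A\<^sup>2 + B\<^sup>2 - 2 * A * B * cos (b - a)"
proof -
  have "(cmod (of_real A * cis a - of_real B * cis b))\<^sup>2
      = A\<^sup>2 * ((sin a)\<^sup>2 + (cos a)\<^sup>2) + B\<^sup>2 * ((sin b)\<^sup>2 + (cos b)\<^sup>2)
        - 2 * A * B * (cos b * cos a + sin b * sin a)"
    unfolding cmod_power2
    \<comment> \<open>The Pythagorean rule is held back so that both sides expand to the same
      polynomial in sines and cosines.\<close>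
    by (simp add: power2_eq_square algebra_simps del: sin_cos_squared_add3)
  then show ?thesis
    by (simp add: cos_diff)
qed

text \<open>Cosine is even and decreasing on \<open>[0, pi]\<close>, so it may be compared at
  \<open>\<bar>x\<bar>\<close> and \<open>\<sigma>\<close>.\<close>

lemma cos_le_cos_of_abs_le:
  assumes "x \<in> {-\<sigma>..\<sigma>}" "\<sigma> \<le> pi"
  shows "cos \<sigma> \<le> cos x"
  using assms cos_monotone_0_pi_le[of "\<bar>x\<bar>" \<sigma>] by (simp add: abs_le_iff)

lemma cmod_diff_scaled_cis_squared_le:
  assumes "b - a \<in> {-\<sigma>..\<sigma>}" "\<sigma> \<le> pi" "A \<ge> 0" "B \<ge> 0"
  shows "(cmod (of_real A * cis a - of_real B * cis b))\<^sup>2 \<le> A\<^sup>2 + B\<^sup>2 - 2 * A * B * cos \<sigma>"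
proof -
  have "2 * A * B * cos \<sigma> \<le> 2 * A * B * cos (b - a)"
    using assms by (intro mult_left_mono cos_le_cos_of_abs_le) auto
  then show ?thesis
    by (simp add: cmod_diff_scaled_cis_squared)
qed

lemma cmod_interference_squared_le:
  assumes "A \<ge> 0" "B \<ge> 0"
  shows "(cmod (x * of_real A * cis a - y * of_real B * cis b))\<^sup>2 \<le> (cmod x * A + cmod y * B)\<^sup>2"
proof (rule power_mono)
  have "cmod (x * of_real A * cis a - y * of_real B * cis b)
      \<le> cmod (x * of_real A * cis a) + cmod (y * of_real B * cis b)"
    by (rule norm_triangle_ineq4)
  then show "cmod (x * of_real A * cis a - y * of_real B * cis b) \<le> cmod x * A + cmod y * B"
    using assms by (simp add: norm_mult)
qed simp

lemma prob1_le:
  assumes tr: "t\<^sup>2 + r\<^sup>2 = 1" and \<sigma>: "\<sigma> \<le> pi"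
    and c: "c = (t\<^sup>2)\<^sup>2 + (r\<^sup>2)\<^sup>2 - 2 * t\<^sup>2 * r\<^sup>2 * cos \<sigma>"
    and \<psi>: "\<psi> \<in> separable_states" and \<epsilon>: "\<epsilon> \<in> admissible_phases \<sigma>"
  shows "prob1 t r \<psi> \<epsilon> \<le> 1 / 2 + c / 2"
proof -
  obtain \<alpha> \<beta> \<gamma> \<delta> where \<psi>_eq: "\<psi> = (\<alpha>, \<beta>, \<gamma>, \<delta>)"
    by (metis prod_cases4)
  define a b g d where "a = cmod \<alpha>" and "b = cmod \<beta>" and "g = cmod \<gamma>" and "d = cmod \<delta>"
  note amps = a_def b_def g_def d_def
  define T R k where "T = t\<^sup>2" and "R = r\<^sup>2" and "k = cos \<sigma>"
  have TR: "T \<ge> 0" "R \<ge> 0" "T + R = 1" and k: "-1 \<le> k" "k \<le> 1"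
    using tr by (simp_all add: T_def R_def k_def)
  have c': "c = T\<^sup>2 + R\<^sup>2 - 2 * T * R * k"
    using c by (simp add: T_def R_def k_def)
  have "\<alpha> * \<beta> = \<gamma> * \<delta>" and norm1: "a\<^sup>2 + b\<^sup>2 + g\<^sup>2 + d\<^sup>2 = 1"
    using \<psi> by (auto simp: separable_states_def \<psi>_eq amps)
  then have sep: "a * b = g * d"
    by (metis amps norm_mult)
  have P: "prob1 t r \<psi> \<epsilon> =
     a\<^sup>2 * (cmod (of_real T * cis (\<epsilon> $ 1) - of_real R * cis (\<epsilon> $ 2)))\<^sup>2 +
     b\<^sup>2 * (cmod (of_real T * cis (\<epsilon> $ 7) - of_real R * cis (\<epsilon> $ 8)))\<^sup>2 +
     (cmod (\<delta> * of_real T * cis (\<epsilon> $ 3) - \<gamma> * of_real R * cis (\<epsilon> $ 4)))\<^sup>2 +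
     (cmod (\<gamma> * of_real T * cis (\<epsilon> $ 5) - \<delta> * of_real R * cis (\<epsilon> $ 6)))\<^sup>2"
    by (simp add: prob1_def \<psi>_eq amps T_def R_def)
  have "prob1 t r \<psi> \<epsilon> \<le> a\<^sup>2 * c + b\<^sup>2 * c + (d * T + g * R)\<^sup>2 + (g * T + d * R)\<^sup>2"
    unfolding P c' k_def g_def d_def using \<epsilon> \<sigma> TR
    by (intro add_mono mult_left_mono cmod_diff_scaled_cis_squared_le
        cmod_interference_squared_le) (auto simp: admissible_phases_def)
  also have "\<dots> = (a\<^sup>2 + b\<^sup>2) * c + (g\<^sup>2 + d\<^sup>2) * (T\<^sup>2 + R\<^sup>2) + 2 * T * R * (2 * (g * d))"
    by (simp add: power2_eq_square algebra_simps)
  also have "\<dots> \<le> (a\<^sup>2 + b\<^sup>2) * c + (g\<^sup>2 + d\<^sup>2) * (T\<^sup>2 + R\<^sup>2)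
      + 2 * T * R * ((1 + k) / 2 * (a\<^sup>2 + b\<^sup>2) + (1 - k) / 2 * (g\<^sup>2 + d\<^sup>2))"
  proof -
    \<comment> \<open>Here \<open>sep\<close> replaces \<open>g * d\<close> by \<open>a * b\<close>
      before the AM-GM inequality; the weight is nonnegative since
      \<open>k \<ge> -1\<close>.\<close>
    have "(1 + k) / 2 * (2 * (g * d)) \<le> (1 + k) / 2 * (a\<^sup>2 + b\<^sup>2)"
      using k sum_squares_bound[of a b] sep by (intro mult_left_mono) auto
    moreover have "(1 - k) / 2 * (2 * (g * d)) \<le> (1 - k) / 2 * (g\<^sup>2 + d\<^sup>2)"
      using k sum_squares_bound[of g d] by (intro mult_left_mono) auto
    ultimately have "2 * (g * d) \<le> (1 + k) / 2 * (a\<^sup>2 + b\<^sup>2) + (1 - k) / 2 * (g\<^sup>2 + d\<^sup>2)"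
      by (simp add: field_simps)
    then show ?thesis
      using TR by (intro add_left_mono mult_left_mono) auto
  qed
  \<comment> \<open>The coefficients \<open>c + T * R * (1 + k)\<close> and
    \<open>T\<^sup>2 + R\<^sup>2 + T * R * (1 - k)\<close> coincide; this equality dictates the
    weights.\<close>
  also have "\<dots> = (a\<^sup>2 + b\<^sup>2 + g\<^sup>2 + d\<^sup>2) * (((T + R)\<^sup>2 + c) / 2)"
    unfolding c' by (simp add: power2_eq_square field_simps)
  also have "\<dots> = 1 / 2 + c / 2"
    using norm1 TR by (simp add: add_divide_distrib)
  finally show ?thesis .
qed

lemma prob1_attained:
  assumes tr: "t\<^sup>2 + r\<^sup>2 = 1" and \<sigma>: "\<sigma> \<ge> 0"
    and c: "c = (t\<^sup>2)\<^sup>2 + (r\<^sup>2)\<^sup>2 - 2 * t\<^sup>2 * r\<^sup>2 * cos \<sigma>"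
  shows "\<exists>\<psi> \<in> separable_states. \<exists>\<epsilon> \<in> admissible_phases \<sigma>. prob1 t r \<psi> \<epsilon> = 1 / 2 + c / 2"
proof (intro bexI)
  \<comment> \<open>This is the product of \<open>|0> + |1>\<close> and \<open>|0> - |1>\<close>,
    normalised. Equal moduli make AM-GM tight, and the opposite signs of \<gamma> and \<delta> make
    the last two terms interfere constructively.\<close>
  let ?\<psi> = "(1/2, -1/2, 1/2, -1/2) :: amplitudes"
  \<comment> \<open>The first and last pairs get the extreme relative error \<sigma>; the two middle
    pairs get 0, which keeps their interference constructive.\<close>
  let ?\<epsilon> = "(\<chi> i. if i = 2 \<or> i = 8 then \<sigma> else 0) :: real ^ 8"
  have abs: "(cmod (of_real (t\<^sup>2) * cis 0 - of_real (r\<^sup>2) * cis \<sigma>))\<^sup>2 = c"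
    using c by (simp only: cmod_diff_scaled_cis_squared) simp
  have "(of_real t)\<^sup>2 + (of_real r)\<^sup>2 = (1 :: complex)"
    using tr by (metis of_real_add of_real_power of_real_1)
  \<comment> \<open>Up to sign these are the amplitudes inside the last two terms of
    \<open>prob1\<close> at the witness.\<close>
  then have "(of_real t)\<^sup>2 / 2 + (of_real r)\<^sup>2 / 2 = (1 / 2 :: complex)"
       "- ((of_real t)\<^sup>2 / 2) - (of_real r)\<^sup>2 / 2 = (- 1 / 2 :: complex)"
    by algebra+
  then have interf:
    "(cmod ((of_real t)\<^sup>2 / 2 + (of_real r)\<^sup>2 / 2))\<^sup>2 = 1 / 4"
    "(cmod (- ((of_real t)\<^sup>2 / 2) - (of_real r)\<^sup>2 / 2))\<^sup>2 = 1 / 4"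
    by (simp_all only: norm_divide norm_minus_cancel norm_one norm_numeral power_divide) simp_all
  show "?\<psi> \<in> separable_states"
    by (simp add: separable_states_def power2_eq_square)
  show "?\<epsilon> \<in> admissible_phases \<sigma>"
    using \<sigma> by (simp add: admissible_phases_def)
  show "prob1 t r ?\<psi> ?\<epsilon> = 1 / 2 + c / 2"
    using abs interf by (simp add: prob1_def power_divide)
qed

theorem mainTheorem4:
  fixes t r \<sigma> c :: real
  assumes "t \<ge> 0" and "r \<ge> 0" and "t\<^sup>2 + r\<^sup>2 = 1"
    and "\<sigma> \<in> {0..pi}"
    and "c = t ^ 4 + r ^ 4 - 2 * r\<^sup>2 * t\<^sup>2 * cos \<sigma>"
  shows "(\<exists>\<psi> \<in> separable_states. \<exists>\<epsilon> \<in> admissible_phases \<sigma>. prob1 t r \<psi> \<epsilon> = 1 / 2 + c / 2) \<and>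
         (\<forall>\<psi> \<in> separable_states. \<forall>\<epsilon> \<in> admissible_phases \<sigma>. prob1 t r \<psi> \<epsilon> \<le> 1 / 2 + c / 2)"
proof -
  have c: "c = (t\<^sup>2)\<^sup>2 + (r\<^sup>2)\<^sup>2 - 2 * t\<^sup>2 * r\<^sup>2 * cos \<sigma>"
    using assms by simp
  show ?thesis
    using prob1_attained[OF assms(3) _ c] prob1_le[OF assms(3) _ c] assms(4) by auto
qed

end
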